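(* Let $M$ be a manifold equipped with a measure $\mu$, let $\mathbf X=\{X_1,\dots,X_r\}$ be a Hörmander system on $M$, and let $\mathcal L=-\sum_{j=1}^rX_j^2$ be the associated sub-Laplacian. Let $s>0$. Then $$\gamma^s_{\mathbf X,L^2}(M)\subset\gamma^s_{\mathcal L}(M).$$
   Context: Manifolds are smooth and measures on them are always assumed Borel and regular. A Hörmander system is a family of (smooth, globally defined) real-valued vector fields on $M$ such that at every $x\in M$ the real Lie algebra generated by the family coincides with the tangent space $T_x(M)$. For $a\in\mathbb N$, $T_a^r$ is the set of $a$-tuples $I=(i_1,\dots,i_a)$ of integers in $\{1,\dots,r\}$; $\alpha_{I,j}$ is the number of indices among $i_1,\dots,i_a$ equal to $j$; $|I|:=\alpha_{I,1}+\dots+\alpha_{I,r}=a$; $I!:=\alpha_{I,1}!\cdots\alpha_{I,r}!$; $\mathbf X_I:=X_{i_1}\cdots X_{i_a}$. For $a=0$, $T_0^r=\{\emptyset\}$ and $\mathbf X_\emptyset$ is the identity ($|\emptyset|=0$, $\emptyset!=1$). Derivatives of $L^2$ functions are understood in the sense of distributions. $\gamma^s_{\mathbf X,L^2}(M)$ is the space of $\phi\in L^2(M)$ for which there exist $A,C>0$ with $\|\mathbf X_I\phi\|_{L^2(M)}\le CA^{|I|}(I!)^s$ for all $a\in\mathbb N_0$, $I\in T_a^r$. $\gamma^s_{\mathcal L}(M)$ is the space of $\phi\in L^2(M)$ for which there exist $A,C>0$ with $\|\mathcal L^b\phi\|_{L^2(M)}\le CA^{2b}((2b)!)^s$ for all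 $b\in\mathbb N_0$. *)

theory Defs
  imports "HOL-Analysis.Analysis"
begin

primrec Ck_on :: "nat \<Rightarrow> 'e::real_normed_vector set \<Rightarrow> ('e \<Rightarrow> 'f::real_normed_vector) \<Rightarrow> bool" where
  "Ck_on 0 S f \<longleftrightarrow> continuous_on S f"
| "Ck_on (Suc k) S f \<longleftrightarrow> (\<forall>x\<in>S. f differentiable (at x)) \<and>
     (\<forall>v. Ck_on k S (\<lambda>x. frechet_derivative f (at x) v))"

text \<open>Only meant for open \<open>S\<close>.\<close>

definition smooth_on :: "'e::real_normed_vector set \<Rightarrow> ('e \<Rightarrow> 'f::real_normed_vector) \<Rightarrow> bool" where
  "smooth_on S f \<longleftrightarrow> (\<forall>k. Ck_on k S f)"

text \<open>
  The manifold is the whole type \<open>'a\<close>, with the topology given by its type class; it is modelled on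
  the Euclidean space \<open>'e\<close>.  A chart is a pair of its domain and its coordinate map; the values of
  the coordinate map outside the domain are irrelevant.
\<close>

type_synonym ('a, 'e) chart = "'a set \<times> ('a \<Rightarrow> 'e)"

definition chart_image :: "('a, 'e) chart \<Rightarrow> 'e set" where
  "chart_image c = snd c ` fst c"

definition chart_inv :: "('a, 'e) chart \<Rightarrow> 'e \<Rightarrow> 'a" where
  "chart_inv c = inv_into (fst c) (snd c)"

definition is_chart :: "('a::topological_space, 'e::euclidean_space) chart \<Rightarrow> bool" where
  "is_chart c \<longleftrightarrow> open (fst c) \<and> open (chart_image c) \<and>
     homeomorphism (fst c) (chart_image c) (snd c) (chart_inv c)"

definition transition :: "('a, 'e) chart \<Rightarrow> ('a, 'e) chart \<Rightarrow> 'e \<Rightarrow> 'e" where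
  "transition c d = snd d \<circ> chart_inv c"

definition compatible :: "('a, 'e::euclidean_space) chart \<Rightarrow> ('a, 'e) chart \<Rightarrow> bool" where
  "compatible c d \<longleftrightarrow>
     smooth_on (snd c ` (fst c \<inter> fst d)) (transition c d) \<and>
     smooth_on (snd d ` (fst c \<inter> fst d)) (transition d c)"

definition smooth_structure ::
  "('a::{t2_space, second_countable_topology}, 'e::euclidean_space) chart set \<Rightarrow> bool" where
  "smooth_structure \<A> \<longleftrightarrow>
     (\<forall>c\<in>\<A>. is_chart c) \<and> (\<Union>c\<in>\<A>. fst c) = UNIV \<and>
     (\<forall>c\<in>\<A>. \<forall>d\<in>\<A>. compatible c d) \<and>
     (\<forall>c. is_chart c \<and> (\<forall>d\<in>\<A>. compatible c d) \<longrightarrow> c \<in> \<A>)"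

definition charts_at :: "('a, 'e) chart set \<Rightarrow> 'a \<Rightarrow> ('a, 'e) chart set" where
  "charts_at \<A> x = {c\<in>\<A>. x \<in> fst c}"

text \<open>
  A tangent vector at \<open>x\<close> is the family of its coordinate vectors in all the charts at \<open>x\<close>
  (extended by \<open>0\<close> to the other charts), related by the differentials of the transition maps.
\<close>

type_synonym ('a, 'e) tvec = "('a, 'e) chart \<Rightarrow> 'e"

type_synonym ('a, 'e) vfield = "'a \<Rightarrow> ('a, 'e) tvec"

definition tangent_space ::
  "('a, 'e::euclidean_space) chart set \<Rightarrow> 'a \<Rightarrow> ('a, 'e) tvec set" where
  "tangent_space \<A> x = {v. (\<forall>c. c \<notin> charts_at \<A> x \<longrightarrow> v c = 0) \<and>
     (\<forall>c\<in>charts_at \<A> x. \<forall>d\<in>charts_at \<A> x.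
        v d = frechet_derivative (transition c d) (at (snd c x)) (v c))}"

definition coord_rep :: "('a, 'e) vfield \<Rightarrow> ('a, 'e) chart \<Rightarrow> 'e \<Rightarrow> 'e" where
  "coord_rep X c y = X (chart_inv c y) c"

definition smooth_vector_field ::
  "('a, 'e::euclidean_space) chart set \<Rightarrow> ('a, 'e) vfield \<Rightarrow> bool" where
  "smooth_vector_field \<A> X \<longleftrightarrow>
     (\<forall>x. X x \<in> tangent_space \<A> x) \<and> (\<forall>c\<in>\<A>. smooth_on (chart_image c) (coord_rep X c))"

definition lie_bracket ::
  "('a, 'e::euclidean_space) chart set \<Rightarrow> ('a, 'e) vfield \<Rightarrow> ('a, 'e) vfield \<Rightarrow> ('a, 'e) vfield" where
  "lie_bracket \<A> X Y x c =
     (if c \<in> charts_at \<A> x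
      then frechet_derivative (coord_rep Y c) (at (snd c x)) (X x c)
         - frechet_derivative (coord_rep X c) (at (snd c x)) (Y x c)
      else 0)"

inductive_set lie_generated ::
  "('a, 'e::euclidean_space) chart set \<Rightarrow> ('a, 'e) vfield set \<Rightarrow> ('a, 'e) vfield set"
  for \<A> \<X> where
  gen: "X \<in> \<X> \<Longrightarrow> X \<in> lie_generated \<A> \<X>"
| zero: "(\<lambda>x c. 0) \<in> lie_generated \<A> \<X>"
| add: "\<lbrakk>X \<in> lie_generated \<A> \<X>; Y \<in> lie_generated \<A> \<X>\<rbrakk>
        \<Longrightarrow> (\<lambda>x c. X x c + Y x c) \<in> lie_generated \<A> \<X>"
| scale: "X \<in> lie_generated \<A> \<X> \<Longrightarrow> (\<lambda>x c. t *\<^sub>R X x c) \<in> lie_generated \<A> \<X>" for t :: real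
| bracket: "\<lbrakk>X \<in> lie_generated \<A> \<X>; Y \<in> lie_generated \<A> \<X>\<rbrakk>
        \<Longrightarrow> lie_bracket \<A> X Y \<in> lie_generated \<A> \<X>"

text \<open>The system is \<open>X 1, \<dots>, X r\<close>; the values of \<open>X\<close> at other indices are irrelevant.\<close>

definition hoermander_system ::
  "('a, 'e::euclidean_space) chart set \<Rightarrow> nat \<Rightarrow> (nat \<Rightarrow> ('a, 'e) vfield) \<Rightarrow> bool" where
  "hoermander_system \<A> r X \<longleftrightarrow>
     (\<forall>j\<in>{1..r}. smooth_vector_field \<A> (X j)) \<and>
     (\<forall>x. (\<lambda>Z. Z x) ` lie_generated \<A> (X ` {1..r}) = tangent_space \<A> x)"

definition regular_borel_measure :: "'a::topological_space measure \<Rightarrow> bool" where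
  "regular_borel_measure \<mu> \<longleftrightarrow> sets \<mu> = sets borel \<and>
     (\<forall>K. compact K \<longrightarrow> emeasure \<mu> K < \<infinity>) \<and>
     (\<forall>B\<in>sets borel. emeasure \<mu> B = (INF U\<in>{U. open U \<and> B \<subseteq> U}. emeasure \<mu> U)) \<and>
     (\<forall>U. open U \<longrightarrow> emeasure \<mu> U = (SUP K\<in>{K. compact K \<and> K \<subseteq> U}. emeasure \<mu> K))"

definition L2 :: "'a measure \<Rightarrow> ('a \<Rightarrow> complex) set" where
  "L2 \<mu> = {f \<in> borel_measurable \<mu>. integrable \<mu> (\<lambda>x. (cmod (f x))\<^sup>2)}"

definition L2_norm :: "'a measure \<Rightarrow> ('a \<Rightarrow> complex) \<Rightarrow> real" where
  "L2_norm \<mu> f = sqrt (LINT x|\<mu>. (cmod (f x))\<^sup>2)"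

text \<open>
  A distribution on the manifold is given by its local representatives: for each chart \<open>c\<close>, a
  functional on the test functions on the open set \<open>chart_image c\<close>.  A function \<open>f\<close> has the
  representatives \<open>f \<circ> chart_inv c\<close>, acting by integration against Lebesgue measure in the
  coordinates.  Linearity, continuity and the coordinate change law are not built into the type:
  they hold for functions and are preserved by the operations below, and no other functionals are used.
\<close>

type_synonym ('a, 'e) distr = "('a, 'e) chart \<Rightarrow> ('e \<Rightarrow> complex) \<Rightarrow> complex"

definition test_functions :: "'e::euclidean_space set \<Rightarrow> ('e \<Rightarrow> complex) set" where
  "test_functions V = {\<psi>. smooth_on UNIV \<psi> \<and>
     compact (closure {y. \<psi> y \<noteq> 0}) \<and> closure {y. \<psi> y \<noteq> 0} \<subseteq> V}"

definition distr_eq ::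
  "('a, 'e::euclidean_space) chart set \<Rightarrow> ('a, 'e) distr \<Rightarrow> ('a, 'e) distr \<Rightarrow> bool" where
  "distr_eq \<A> u v \<longleftrightarrow> (\<forall>c\<in>\<A>. \<forall>\<psi>\<in>test_functions (chart_image c). u c \<psi> = v c \<psi>)"

definition locally_integrable ::
  "('a, 'e::euclidean_space) chart set \<Rightarrow> ('a \<Rightarrow> complex) \<Rightarrow> bool" where
  "locally_integrable \<A> f \<longleftrightarrow> (\<forall>c\<in>\<A>. \<forall>K. compact K \<and> K \<subseteq> chart_image c \<longrightarrow>
     set_integrable lborel K (f \<circ> chart_inv c))"

definition distr_of :: "('a \<Rightarrow> complex) \<Rightarrow> ('a, 'e::euclidean_space) distr" where
  "distr_of f c \<psi> = (LINT y:chart_image c|lborel. f (chart_inv c y) * \<psi> y)"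

text \<open>
  In coordinates a vector field is \<open>\<Sum>b. X\<^sub>b \<partial>\<^sub>b\<close>, and its formal transpose with respect to
  Lebesgue measure is \<open>\<psi> \<mapsto> - \<Sum>b. \<partial>\<^sub>b (X\<^sub>b \<psi>)\<close>.
\<close>

definition vf_distr ::
  "('a, 'e::euclidean_space) vfield \<Rightarrow> ('a, 'e) distr \<Rightarrow> ('a, 'e) distr" where
  "vf_distr X u c \<psi> = - u c (\<lambda>y. \<Sum>b\<in>Basis.
     frechet_derivative (\<lambda>z. (coord_rep X c z \<bullet> b) *\<^sub>R \<psi> z) (at y) b)"

definition sub_laplacian ::
  "nat \<Rightarrow> (nat \<Rightarrow> ('a, 'e::euclidean_space) vfield) \<Rightarrow> ('a, 'e) distr \<Rightarrow> ('a, 'e) distr" where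
  "sub_laplacian r X u c \<psi> = - (\<Sum>j=1..r. vf_distr (X j) (vf_distr (X j) u) c \<psi>)"

text \<open>
  \<open>L2_norm_le \<A> \<mu> u t\<close> means that the distribution \<open>u\<close> is a function in \<open>L\<^sup>2(\<mu>)\<close> of norm at most \<open>t\<close>.
  As \<open>\<mu>\<close> is not assumed to have a smooth positive density in the charts, local integrability with
  respect to Lebesgue measure in the charts has to be required for a function to define a
  distribution; when \<open>\<mu>\<close> does have such a density, it is automatic on \<open>L\<^sup>2(\<mu>)\<close>.
\<close>

definition L2_norm_le ::
  "('a, 'e::euclidean_space) chart set \<Rightarrow> 'a measure \<Rightarrow> ('a, 'e) distr \<Rightarrow> real \<Rightarrow> bool" where
  "L2_norm_le \<A> \<mu> u t \<longleftrightarrow>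
     (\<exists>g\<in>L2 \<mu>. locally_integrable \<A> g \<and> distr_eq \<A> u (distr_of g) \<and> L2_norm \<mu> g \<le> t)"

definition tuples :: "nat \<Rightarrow> nat \<Rightarrow> nat list set" where
  "tuples r a = {I. length I = a \<and> set I \<subseteq> {1..r}}"

definition tuple_fact :: "nat \<Rightarrow> nat list \<Rightarrow> nat" where
  "tuple_fact r I = (\<Prod>j=1..r. fact (count_list I j))"

definition vf_tuple ::
  "(nat \<Rightarrow> ('a, 'e::euclidean_space) vfield) \<Rightarrow> nat list \<Rightarrow> ('a, 'e) distr \<Rightarrow> ('a, 'e) distr" where
  "vf_tuple X I = foldr (\<lambda>i. vf_distr (X i)) I"

definition gevrey_X ::
  "('a, 'e::euclidean_space) chart set \<Rightarrow> 'a measure \<Rightarrow> nat \<Rightarrow> (nat \<Rightarrow> ('a, 'e) vfield) \<Rightarrow> real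
   \<Rightarrow> ('a \<Rightarrow> complex) set" where
  "gevrey_X \<A> \<mu> r X s = {\<phi>\<in>L2 \<mu>. locally_integrable \<A> \<phi> \<and>
     (\<exists>A>0. \<exists>C>0. \<forall>a. \<forall>I\<in>tuples r a.
        L2_norm_le \<A> \<mu> (vf_tuple X I (distr_of \<phi>))
          (C * A ^ length I * real (tuple_fact r I) powr s))}"

definition gevrey_L ::
  "('a, 'e::euclidean_space) chart set \<Rightarrow> 'a measure \<Rightarrow> nat \<Rightarrow> (nat \<Rightarrow> ('a, 'e) vfield) \<Rightarrow> real
   \<Rightarrow> ('a \<Rightarrow> complex) set" where
  "gevrey_L \<A> \<mu> r X s = {\<phi>\<in>L2 \<mu>. locally_integrable \<A> \<phi> \<and>
     (\<exists>A>0. \<exists>C>0. \<forall>b.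
        L2_norm_le \<A> \<mu> ((sub_laplacian r X ^^ b) (distr_of \<phi>))
          (C * A ^ (2 * b) * fact (2 * b) powr s))}"

end

theory Submission
  imports Defs
begin

text \<open>
  \<open>\<L>\<^sup>b \<phi>\<close> is, up to sign, the sum of the \<open>r\<^sup>b\<close> derivatives \<open>X\<^bsub>j\<^sub>1\<^esub>\<^sup>2 \<cdots> X\<^bsub>j\<^sub>b\<^esub>\<^sup>2 \<phi>\<close>, each of which is an
  \<open>\<X>\<^sub>I \<phi>\<close> with \<open>|I| = 2b\<close>.  Since \<open>I! \<le> (2b)!\<close>, the Gevrey bounds on the \<open>\<X>\<^sub>I \<phi>\<close> add up to the bound
  for \<open>\<L>\<^sup>b \<phi>\<close>, the factor \<open>r\<^sup>b\<close> being absorbed in the constant \<open>A\<close>.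
\<close>

section \<open>Factorials and enumeration of tuples\<close>

lemma prod_fact_le_fact_sum:
  assumes "finite S"
  shows "(\<Prod>i\<in>S. fact (f i)) \<le> (fact (\<Sum>i\<in>S. f i) :: nat)"
  using assms
proof (induction S rule: finite_induct)
  case (insert i S)
  have "fact (f i) * (\<Prod>i\<in>S. fact (f i)) \<le> (fact (f i) * fact (\<Sum>i\<in>S. f i) :: nat)"
    using insert.IH by simp
  also have "\<dots> \<le> fact (f i + (\<Sum>i\<in>S. f i))"
    \<comment> \<open>The quotient of the two sides is a binomial coefficient.\<close>
    by (intro dvd_imp_le fact_fact_dvd_fact) simp
  finally show ?case
    using insert.hyps by simp
qed simp

text \<open>All entries of \<open>I\<close> lie in \<open>{1..r}\<close>, so their multiplicities
  add up to the length \<open>a\<close>, and \<open>a!\<close> divided by the product of their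
  factorials is a multinomial coefficient.\<close>

lemma tuple_fact_le:
  assumes "I \<in> tuples r a"
  shows "tuple_fact r I \<le> fact a"
proof -
  have "(\<Sum>j=1..r. count_list I j) = a"
    using assms by (auto simp: tuples_def intro: sum_count_set)
  then show ?thesis
    using prod_fact_le_fact_sum[of "{1..r}" "count_list I"] by (simp add: tuple_fact_def)
qed

lemma finite_tuples: "finite (tuples r a)"
  using finite_lists_length_eq[of "{1..r}" a] by (simp add: tuples_def conj_commute)

lemma card_tuples: "card (tuples r a) = r ^ a"
  using card_lists_length_eq[of "{1..r}" a] by (simp add: tuples_def conj_commute)

lemma tuples_Suc: "tuples r (Suc a) = (\<lambda>(j, I). j # I) ` ({1..r} \<times> tuples r a)"
  by (auto simp: tuples_def length_Suc_conv image_iff)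

lemma sum_tuples_Suc:
  "(\<Sum>I\<in>tuples r (Suc a). f I) = (\<Sum>j=1..r. \<Sum>I\<in>tuples r a. f (j # I))"
  unfolding tuples_Suc sum.cartesian_product
  by (subst sum.reindex) (auto simp: inj_on_def split_def)

section \<open>Powers of the sub-Laplacian as sums over tuples\<close>

definition repeat_each :: "'b list \<Rightarrow> 'b list" where
  "repeat_each I = concat (map (\<lambda>i. [i, i]) I)"

lemma repeat_each_tuples:
  assumes "I \<in> tuples r b"
  shows "repeat_each I \<in> tuples r (2 * b)"
proof -
  have "length (repeat_each I) = 2 * length I" "set (repeat_each I) = set I"
    by (induction I) (auto simp: repeat_each_def)
  then show ?thesis
    using assms by (simp add: tuples_def)
qed

text \<open>Linearity of distributions is not built into their type, but none is needed here:
  \<open>vf_distr\<close> only evaluates its argument at a transformed test function, so it is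
  linear in that argument for arbitrary functionals \<open>w i\<close>.\<close>

lemma vf_distr_scaled_sum:
  "vf_distr Y (\<lambda>c \<psi>. k * (\<Sum>i\<in>S. w i c \<psi>)) = (\<lambda>c \<psi>. k * (\<Sum>i\<in>S. vf_distr Y (w i) c \<psi>))"
  by (simp add: vf_distr_def fun_eq_iff sum_negf)

text \<open>Expanding the power means choosing one square from each factor. The vector fields need
  not commute, so the order of the choices is kept: \<open>I\<close> records them and
  \<open>repeat_each I\<close> is the resulting word of length \<open>2 * b\<close>. The outermost
  factor supplies the head of \<open>I\<close>, and each factor contributes one sign.\<close>

lemma sub_laplacian_power:
  "(sub_laplacian r X ^^ b) u =
     (\<lambda>c \<psi>. (- 1) ^ b * (\<Sum>I\<in>tuples r b. vf_tuple X (repeat_each I) u c \<psi>))"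
proof (induction b)
  case 0
  have "tuples r 0 = {[]}"
    by (auto simp: tuples_def)
  then show ?case
    by (simp add: vf_tuple_def repeat_each_def)
next
  case (Suc b)
  have "(sub_laplacian r X ^^ Suc b) u = sub_laplacian r X
      (\<lambda>c \<psi>. (- 1) ^ b * (\<Sum>I\<in>tuples r b. vf_tuple X (repeat_each I) u c \<psi>))"
    by (simp add: Suc.IH)
  also have "\<dots> = (\<lambda>c \<psi>. (- 1) ^ Suc b *
      (\<Sum>j=1..r. \<Sum>I\<in>tuples r b. vf_tuple X (repeat_each (j # I)) u c \<psi>))"
    unfolding sub_laplacian_def vf_distr_scaled_sum
    by (simp add: vf_tuple_def repeat_each_def sum_distrib_left sum_negf)
  finally show ?case
    by (simp only: sum_tuples_Suc)
qed

section \<open>Finite sums in L2\<close>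

lemma sum_squared_le_card:
  fixes a :: "'b \<Rightarrow> real"
  shows "(\<Sum>i\<in>S. a i)\<^sup>2 \<le> real (card S) * (\<Sum>i\<in>S. (a i)\<^sup>2)"
  using Cauchy_Schwarz_ineq_sum[of "\<lambda>_. 1" a S] by simp

text \<open>The Cauchy-Schwarz bound of the squared sum by \<open>card S\<close> times the sum of
  squares replaces Minkowski's inequality. It gives an integrable majorant, and for a common bound
  \<open>t\<close> it loses nothing: both routes end at \<open>card S * t\<close>.\<close>

lemma L2_sum:
  assumes "finite S" and g: "\<And>i. i \<in> S \<Longrightarrow> g i \<in> L2 \<mu>"
    and le: "\<And>i. i \<in> S \<Longrightarrow> L2_norm \<mu> (g i) \<le> t"
  shows "(\<lambda>x. \<Sum>i\<in>S. g i x) \<in> L2 \<mu>"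
    and "L2_norm \<mu> (\<lambda>x. \<Sum>i\<in>S. g i x) \<le> real (card S) * t"
proof -
  have meas [measurable]: "(\<lambda>x. \<Sum>i\<in>S. g i x) \<in> borel_measurable \<mu>"
    using g by (intro borel_measurable_sum) (simp add: L2_def)
  have le_sq: "(cmod (\<Sum>i\<in>S. g i x))\<^sup>2 \<le> real (card S) * (\<Sum>i\<in>S. (cmod (g i x))\<^sup>2)" for x
    using sum_squared_le_card[of "\<lambda>i. cmod (g i x)" S] power_mono[OF norm_sum[of "\<lambda>i. g i x" S]]
    by (meson norm_ge_zero order_trans)
  have dom: "integrable \<mu> (\<lambda>x. real (card S) * (\<Sum>i\<in>S. (cmod (g i x))\<^sup>2))"
    using g by (auto simp: L2_def)
  have int: "integrable \<mu> (\<lambda>x. (cmod (\<Sum>i\<in>S. g i x))\<^sup>2)"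
    by (rule Bochner_Integration.integrable_bound[OF dom])
      (simp_all add: order_trans[OF le_sq abs_ge_self])
  show "(\<lambda>x. \<Sum>i\<in>S. g i x) \<in> L2 \<mu>"
    using int meas by (simp add: L2_def)
  show "L2_norm \<mu> (\<lambda>x. \<Sum>i\<in>S. g i x) \<le> real (card S) * t"
  \<comment> \<open>For nonempty \<open>S\<close> a single norm bound forces
    \<open>t \<ge> 0\<close>, so the root of \<open>(card S * t)\<^sup>2\<close> is
    \<open>card S * t\<close>. For empty \<open>S\<close>, \<open>t\<close> may be negative, but
    both sides are 0.\<close>
  proof (cases "S = {}")
    case False
    have nonneg: "0 \<le> L2_norm \<mu> f" for f
      by (simp add: L2_norm_def)
    have "t \<ge> 0"
      using False le nonneg by (meson all_not_in_conv order_trans)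
    have "(LINT x|\<mu>. (cmod (g i x))\<^sup>2) \<le> t\<^sup>2" if "i \<in> S" for i
    proof -
      have "(LINT x|\<mu>. (cmod (g i x))\<^sup>2) = (L2_norm \<mu> (g i))\<^sup>2"
        by (simp add: L2_norm_def)
      also have "\<dots> \<le> t\<^sup>2"
        by (intro power_mono le that nonneg)
      finally show ?thesis .
    qed
    then have sum_le: "(\<Sum>i\<in>S. LINT x|\<mu>. (cmod (g i x))\<^sup>2) \<le> real (card S) * t\<^sup>2"
      by (rule sum_bounded_above)
    have "(LINT x|\<mu>. (cmod (\<Sum>i\<in>S. g i x))\<^sup>2)
        \<le> (LINT x|\<mu>. real (card S) * (\<Sum>i\<in>S. (cmod (g i x))\<^sup>2))"
      by (intro integral_mono int dom le_sq)
    also have "\<dots> = real (card S) * (\<Sum>i\<in>S. LINT x|\<mu>. (cmod (g i x))\<^sup>2)"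
      using g by (subst integral_mult_right_zero, subst Bochner_Integration.integral_sum)
        (auto simp: L2_def)
    also have "\<dots> \<le> real (card S) * (real (card S) * t\<^sup>2)"
      by (intro mult_left_mono sum_le) simp
    finally have "L2_norm \<mu> (\<lambda>x. \<Sum>i\<in>S. g i x) \<le> sqrt ((real (card S) * t)\<^sup>2)"
      by (simp add: L2_norm_def power2_eq_square algebra_simps)
    then show ?thesis
      using \<open>t \<ge> 0\<close> by simp
  qed (simp add: L2_norm_def)
qed

section \<open>Additivity of the passage from functions to distributions\<close>

lemma set_integrable_mult_test_function:
  assumes "locally_integrable \<A> g" and "c \<in> \<A>" and \<psi>: "\<psi> \<in> test_functions (chart_image c)"
  shows "set_integrable lborel (chart_image c) (\<lambda>y. g (chart_inv c y) * \<psi> y)"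
proof -
  define K where "K = closure {y. \<psi> y \<noteq> 0}"
  have K: "compact K" "K \<subseteq> chart_image c" and "smooth_on UNIV \<psi>"
    using \<psi> by (auto simp: test_functions_def K_def)
  then have "Ck_on 0 UNIV \<psi>"
    by (simp only: smooth_on_def)
  then have cont: "continuous_on UNIV \<psi>"
    by simp
  have zero: "\<psi> y = 0" if "y \<notin> K" for y
    using that closure_subset[of "{y. \<psi> y \<noteq> 0}"] by (auto simp: K_def)
  have "bounded (\<psi> ` K)"
    using K cont by (meson compact_continuous_image compact_imp_bounded continuous_on_subset subset_UNIV)
  then obtain B where B: "\<And>y. y \<in> K \<Longrightarrow> cmod (\<psi> y) \<le> B"
    by (auto simp: bounded_iff)
  have [measurable]: "\<psi> \<in> borel_measurable borel"
    using cont by (rule borel_measurable_continuous_onI)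
  have int: "integrable lborel (\<lambda>y. indicator K y *\<^sub>R g (chart_inv c y))"
    using assms K by (simp add: locally_integrable_def set_integrable_def)
  \<comment> \<open>Nothing is assumed about measurability of \<open>g\<close> itself; on the
    support \<open>K\<close> it is part of local integrability.\<close>
  have [measurable]: "(\<lambda>y. indicator K y *\<^sub>R g (chart_inv c y)) \<in> borel_measurable borel"
    using borel_measurable_integrable[OF int] by simp
  have "integrable lborel (\<lambda>y. (indicator K y *\<^sub>R g (chart_inv c y)) * \<psi> y)"
  proof (rule Bochner_Integration.integrable_bound)
    \<comment> \<open>The majorant uses that the test function is bounded on \<open>K\<close>. If
      \<open>K\<close> is empty, \<open>B\<close> may be negative, hence the absolute value of
      \<open>B\<close> below.\<close>
    show "integrable lborel (\<lambda>y. B *\<^sub>R (indicator K y *\<^sub>R g (chart_inv c y)))"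
      using int by (rule integrable_scaleR_right)
    show "AE y in lborel. norm ((indicator K y *\<^sub>R g (chart_inv c y)) * \<psi> y)
        \<le> norm (B *\<^sub>R (indicator K y *\<^sub>R g (chart_inv c y)))"
    proof (intro AE_I2)
      fix y
      show "norm ((indicator K y *\<^sub>R g (chart_inv c y)) * \<psi> y)
        \<le> norm (B *\<^sub>R (indicator K y *\<^sub>R g (chart_inv c y)))"
        using B[of y] mult_left_mono[of "cmod (\<psi> y)" "\<bar>B\<bar>" "cmod (g (chart_inv c y))"]
        by (cases "y \<in> K") (auto simp: norm_mult mult.commute)
    qed
  qed measurable
  \<comment> \<open>The test function vanishes off \<open>K\<close>, so \<open>K\<close> may be
    enlarged to the whole chart image.\<close>
  moreover have "(\<lambda>y. (indicator K y *\<^sub>R g (chart_inv c y)) * \<psi> y) =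
      (\<lambda>y. indicator (chart_image c) y *\<^sub>R (g (chart_inv c y) * \<psi> y))"
    using zero K by (auto simp: fun_eq_iff indicator_def)
  ultimately show ?thesis
    by (simp add: set_integrable_def)
qed

lemma locally_integrable_sum:
  assumes "\<And>i. i \<in> S \<Longrightarrow> locally_integrable \<A> (g i)"
  shows "locally_integrable \<A> (\<lambda>x. \<Sum>i\<in>S. g i x)"
  using assms by (auto simp: locally_integrable_def set_integrable_def scaleR_sum_right)

text \<open>The integral of a non-integrable function has the default value 0, so splitting the sum
  requires each product to be integrable. This holds for charts of the atlas and test functions on
  their images, exactly the pairs tested by \<open>distr_eq\<close>.\<close>

lemma distr_of_sum:
  assumes "\<And>i. i \<in> S \<Longrightarrow> locally_integrable \<A> (g i)"
    and "c \<in> \<A>" and "\<psi> \<in> test_functions (chart_image c)"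
  shows "distr_of (\<lambda>x. \<Sum>i\<in>S. g i x) c \<psi> = (\<Sum>i\<in>S. distr_of (g i) c \<psi>)"
proof -
  have "integrable lborel (\<lambda>y. indicator (chart_image c) y *\<^sub>R (g i (chart_inv c y) * \<psi> y))"
    if "i \<in> S" for i
    using set_integrable_mult_test_function[OF assms(1)[OF that] assms(2,3)]
    by (simp add: set_integrable_def)
  then show ?thesis
    unfolding distr_of_def set_lebesgue_integral_def sum_distrib_right scaleR_sum_right
    by (rule Bochner_Integration.integral_sum)
qed

section \<open>Norm bounds for sums and multiples of distributions\<close>

lemma L2_norm_le_sum:
  assumes "finite S" and u: "\<And>i. i \<in> S \<Longrightarrow> L2_norm_le \<A> \<mu> (u i) t"
  shows "L2_norm_le \<A> \<mu> (\<lambda>c \<psi>. \<Sum>i\<in>S. u i c \<psi>) (real (card S) * t)"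
proof -
  have "\<forall>i\<in>S. \<exists>g. g \<in> L2 \<mu> \<and> locally_integrable \<A> g \<and>
      distr_eq \<A> (u i) (distr_of g) \<and> L2_norm \<mu> g \<le> t"
    using u by (auto simp: L2_norm_le_def)
  \<comment> \<open>The sum of the chosen representatives \<open>g i\<close> will represent the sum
    of the distributions.\<close>
  from bchoice[OF this] obtain g where g: "\<And>i. i \<in> S \<Longrightarrow> g i \<in> L2 \<mu>"
    "\<And>i. i \<in> S \<Longrightarrow> locally_integrable \<A> (g i)"
    "\<And>i. i \<in> S \<Longrightarrow> distr_eq \<A> (u i) (distr_of (g i))"
    "\<And>i. i \<in> S \<Longrightarrow> L2_norm \<mu> (g i) \<le> t"
    by blast
  have "distr_eq \<A> (\<lambda>c \<psi>. \<Sum>i\<in>S. u i c \<psi>) (distr_of (\<lambda>x. \<Sum>i\<in>S. g i x))"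
    unfolding distr_eq_def
  proof (intro ballI)
    fix c \<psi> assume c\<psi>: "c \<in> \<A>" "\<psi> \<in> test_functions (chart_image c)"
    then have "(\<Sum>i\<in>S. u i c \<psi>) = (\<Sum>i\<in>S. distr_of (g i) c \<psi>)"
      using g(3) by (intro sum.cong) (simp_all add: distr_eq_def)
    also have "\<dots> = distr_of (\<lambda>x. \<Sum>i\<in>S. g i x) c \<psi>"
      using g(2) c\<psi> by (rule distr_of_sum[symmetric])
    finally show "(\<Sum>i\<in>S. u i c \<psi>) = distr_of (\<lambda>x. \<Sum>i\<in>S. g i x) c \<psi>" .
  qed
  moreover have "(\<lambda>x. \<Sum>i\<in>S. g i x) \<in> L2 \<mu>"
    using \<open>finite S\<close> g(1,4) by (rule L2_sum(1))
  moreover have "L2_norm \<mu> (\<lambda>x. \<Sum>i\<in>S. g i x) \<le> real (card S) * t"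
    using \<open>finite S\<close> g(1,4) by (rule L2_sum(2))
  moreover have "locally_integrable \<A> (\<lambda>x. \<Sum>i\<in>S. g i x)"
    using g(2) by (rule locally_integrable_sum)
  ultimately show ?thesis
    unfolding L2_norm_le_def by blast
qed

text \<open>Serves to remove the sign \<open>(- 1) ^ b\<close>, whose modulus 1 leaves the bound
  unchanged.\<close>

lemma L2_norm_le_scale:
  assumes "L2_norm_le \<A> \<mu> u t"
  shows "L2_norm_le \<A> \<mu> (\<lambda>c \<psi>. k * u c \<psi>) (cmod k * t)"
proof -
  obtain g where g: "g \<in> L2 \<mu>" "locally_integrable \<A> g" "distr_eq \<A> u (distr_of g)"
    "L2_norm \<mu> g \<le> t"
    using assms by (auto simp: L2_norm_le_def)
  have "(\<lambda>x. k * g x) \<in> L2 \<mu>"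
    using g(1) by (auto simp: L2_def norm_mult power_mult_distrib)
  moreover have "locally_integrable \<A> (\<lambda>x. k * g x)"
    using g(2) by (auto simp: locally_integrable_def set_integrable_def simp flip: mult_scaleR_right)
  moreover have "distr_eq \<A> (\<lambda>c \<psi>. k * u c \<psi>) (distr_of (\<lambda>x. k * g x))"
    using g(3) by (simp add: distr_eq_def distr_of_def mult.assoc)
  moreover have "L2_norm \<mu> (\<lambda>x. k * g x) = cmod k * L2_norm \<mu> g"
    by (simp add: L2_norm_def norm_mult power_mult_distrib real_sqrt_mult)
  then have "L2_norm \<mu> (\<lambda>x. k * g x) \<le> cmod k * t"
    using g(4) by (simp add: mult_left_mono)
  ultimately show ?thesis
    unfolding L2_norm_le_def by blast
qed

lemma L2_norm_le_mono:
  assumes "L2_norm_le \<A> \<mu> u t" and "t \<le> t'"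
  shows "L2_norm_le \<A> \<mu> u t'"
  using assms unfolding L2_norm_le_def by (meson order_trans)

text \<open>The factor \<open>r ^ b\<close> counts the words in the expansion of the power. A bound
  \<open>t\<close> common to all words of length \<open>2 * b\<close> covers in particular those of
  the form \<open>repeat_each I\<close>.\<close>

lemma L2_norm_le_sub_laplacian_power:
  assumes "\<And>I. I \<in> tuples r (2 * b) \<Longrightarrow> L2_norm_le \<A> \<mu> (vf_tuple X I u) t"
  shows "L2_norm_le \<A> \<mu> ((sub_laplacian r X ^^ b) u) (real r ^ b * t)"
proof -
  have "L2_norm_le \<A> \<mu> (\<lambda>c \<psi>. \<Sum>I\<in>tuples r b. vf_tuple X (repeat_each I) u c \<psi>)
      (real (card (tuples r b)) * t)"
    by (intro L2_norm_le_sum finite_tuples assms repeat_each_tuples)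
  from L2_norm_le_scale[OF this, of "(- 1) ^ b"] show ?thesis
    by (simp add: sub_laplacian_power card_tuples norm_power)
qed

theorem proposition2p8:
  fixes \<A> :: "('a::{t2_space, second_countable_topology}, 'e::euclidean_space) chart set"
    and \<mu> :: "'a measure"
    and r :: nat
    and X :: "nat \<Rightarrow> ('a, 'e) vfield"
    and s :: real
  assumes "smooth_structure \<A>"
    and "regular_borel_measure \<mu>"
    and "hoermander_system \<A> r X"
    and "s > 0"
  shows "gevrey_X \<A> \<mu> r X s \<subseteq> gevrey_L \<A> \<mu> r X s"
proof
  fix \<phi> assume "\<phi> \<in> gevrey_X \<A> \<mu> r X s"
  then obtain A C where \<phi>: "\<phi> \<in> L2 \<mu>" "locally_integrable \<A> \<phi>" and AC: "A > 0" "C > 0"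
    and bound: "\<And>a I. I \<in> tuples r a \<Longrightarrow> L2_norm_le \<A> \<mu> (vf_tuple X I (distr_of \<phi>))
          (C * A ^ length I * real (tuple_fact r I) powr s)"
    by (auto simp: gevrey_X_def)
  \<comment> \<open>\<open>r + 1\<close> instead of \<open>\<surd>r\<close> keeps the constant positive when \<open>r = 0\<close>.\<close>
  define A' where "A' = A * (real r + 1)"
  have "L2_norm_le \<A> \<mu> ((sub_laplacian r X ^^ b) (distr_of \<phi>))
          (C * A' ^ (2 * b) * fact (2 * b) powr s)" for b
  proof -
    \<comment> \<open>\<open>t\<close> no longer depends on the tuple: the length is fixed at
      \<open>2 * b\<close>, and the tuple factorial is enlarged to \<open>(2b)!\<close>, which is
      compatible with the power \<open>s\<close> because \<open>s > 0\<close>.\<close>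
    define t where "t = C * A ^ (2 * b) * fact (2 * b) powr s"
    have "L2_norm_le \<A> \<mu> (vf_tuple X I (distr_of \<phi>)) t" if I: "I \<in> tuples r (2 * b)" for I
    proof (rule L2_norm_le_mono[OF bound[OF I]])
      have "length I = 2 * b"
        using I by (simp add: tuples_def)
      moreover have "real (tuple_fact r I) \<le> fact (2 * b)"
        using of_nat_mono[OF tuple_fact_le[OF I], where 'a = real] by simp
      ultimately show "C * A ^ length I * real (tuple_fact r I) powr s \<le> t"
        using AC \<open>s > 0\<close> by (auto simp: t_def intro!: mult_left_mono powr_mono2)
    qed
    then have "L2_norm_le \<A> \<mu> ((sub_laplacian r X ^^ b) (distr_of \<phi>)) (real r ^ b * t)"
      by (rule L2_norm_le_sub_laplacian_power)
    \<comment> \<open>The enlarged count has the exponent \<open>2 * b\<close> of \<open>A\<close>,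
      so both combine into \<open>A' ^ (2 * b)\<close>.\<close>
    moreover have "real r ^ b \<le> (real r + 1) ^ (2 * b)"
    proof -
      have "real r ^ b \<le> (real r + 1) ^ b"
        by (intro power_mono) auto
      also have "\<dots> \<le> (real r + 1) ^ (2 * b)"
        by (intro power_increasing) auto
      finally show ?thesis .
    qed
    then have "real r ^ b * t \<le> (real r + 1) ^ (2 * b) * t"
      using AC by (intro mult_right_mono) (auto simp: t_def)
    moreover have "(real r + 1) ^ (2 * b) * t = C * A' ^ (2 * b) * fact (2 * b) powr s"
      by (simp add: t_def A'_def power_mult_distrib mult_ac)
    ultimately show ?thesis
      by (metis L2_norm_le_mono)
  qed
  moreover have "A' > 0"
    using AC by (simp add: A'_def)
  ultimately show "\<phi> \<in> gevrey_L \<A> \<mu> r X s"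
    using \<phi> AC unfolding gevrey_L_def by blast
qed

end
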